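(* Let $\Sigma$ be an aggregate signature, $\mathcal D$ a $\Sigma$-structure, $\Pi$ a set of defined predicate symbols, and $P$ a definite $\Sigma(\Pi)$-aggregate program. Then $T_{P,\mathcal D}$ is monotone with respect to $\subseteq$.
   Context: An aggregate relation $R\subseteq\mathcal P(D_1)\times D_2$ is monotone if $(S_1,d)\in R$ and $S_1\subseteq S_2$ imply $(S_2,d)\in R$, anti-monotone if $(S_2,d)\in R$ and $S_1\subseteq S_2$ imply $(S_1,d)\in R$. An aggregate signature $\Sigma$ has sorts, sorted function, predicate and aggregate symbols $\mathsf R:\{s_1\times\dots\times s_n\}\times w$; set expressions $\{(x_1,\dots,x_n)\mid\varphi\}$, aggregate atoms $\mathsf R(s,t)$ and aggregate formulas (atoms, aggregate atoms, closed under $\neg,\wedge,\vee,\forall,\exists$) are defined simultaneously. A $\Sigma$-structure interprets each aggregate symbol by an aggregate relation; a set expression $\{\bar x\mid\varphi(\bar x)\}$ denotes $\{\bar d\mid\mathcal D\models\varphi(\bar d)\}$ and $\mathsf R(s,t)$ holds iff (value of $s$, value of $t$)$\in\mathsf R^{\mathcal D}$; other connectives as in first-order logic. Programs: $\Pi$ is a set of predicate symbols not in $\Sigma$; a rule is $A\leftarrow\varphi$, $A$ a $\Pi$-atom, $\varphi$ a $\Sigma(\Pi)$-aggregate formula; a program is a (possibly infinite) set of rules. Interpretations are subsets $I$ of $base_{\mathcal D}(\Pi)$ (ground $\Pi$-atoms over domain elements); $\mathcal D(I)$ extends $\mathcal D$ making exactly the atoms in $I$ true; $inst_{\mathcal D}(P)$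 is the set of ground instances of rules; $T_{P,\mathcal D}(I)=\{A\mid A\leftarrow\varphi\in inst_{\mathcal D}(P),\ \mathcal D(I)\models\varphi\}$. An occurrence of a predicate in a formula is neutral if it lies inside the condition $\theta$ of an aggregate atom $\mathsf R(\{\bar x\mid\theta\},t)$ with $\mathsf R^{\mathcal D}$ neither monotone nor anti-monotone; otherwise it is positive (resp. negative) if the number of negations and aggregate atoms interpreted by anti-monotone aggregate relations above it is even (resp. odd). A formula is positive if no predicate of $\Pi$ occurs negatively or neutrally. A program is definite if all rule bodies are positive. *)

theory Defs
  imports Main
begin

subsection \<open>Aggregate relations\<close>

definition aggregate_relation :: "'x set \<Rightarrow> 'd set \<Rightarrow> ('x set \<times> 'd) set \<Rightarrow> bool" where
  "aggregate_relation D1 D2 R \<longleftrightarrow> R \<subseteq> Pow D1 \<times> D2"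

(* The larger set must again be a subset of D1, since R is a relation on Pow D1 and D2. *)
definition monotone_aggregate :: "'x set \<Rightarrow> ('x set \<times> 'd) set \<Rightarrow> bool" where
  "monotone_aggregate D1 R \<longleftrightarrow>
     (\<forall>S1 S2 d. S2 \<subseteq> D1 \<longrightarrow> (S1, d) \<in> R \<longrightarrow> S1 \<subseteq> S2 \<longrightarrow> (S2, d) \<in> R)"

definition antimonotone_aggregate :: "('x set \<times> 'd) set \<Rightarrow> bool" where
  "antimonotone_aggregate R \<longleftrightarrow>
     (\<forall>S1 S2 d. (S2, d) \<in> R \<longrightarrow> S1 \<subseteq> S2 \<longrightarrow> (S1, d) \<in> R)"


subsection \<open>Syntax\<close>

(* An aggregate symbol declared with (ss, w) has the sort {s1 x ... x sn} x w. *)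
record ('s, 'f, 'p, 'a) signature =
  sorts :: "'s set"
  func_decl :: "'f \<rightharpoonup> 's list \<times> 's"
  pred_decl :: "'p \<rightharpoonup> 's list"
  agg_decl :: "'a \<rightharpoonup> 's list \<times> 's"

definition aggregate_signature :: "('s, 'f, 'p, 'a) signature \<Rightarrow> bool" where
  "aggregate_signature \<Sigma> \<longleftrightarrow>
     (\<forall>(ss, s) \<in> ran (func_decl \<Sigma>). set ss \<subseteq> sorts \<Sigma> \<and> s \<in> sorts \<Sigma>) \<and>
     (\<forall>ss \<in> ran (pred_decl \<Sigma>). set ss \<subseteq> sorts \<Sigma>) \<and>
     (\<forall>(ss, w) \<in> ran (agg_decl \<Sigma>). set ss \<subseteq> sorts \<Sigma> \<and> w \<in> sorts \<Sigma>)"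

(* The second component of a variable is its sort. *)
type_synonym 's var = "nat \<times> 's"

datatype ('s, 'f) trm =
    Var "'s var"
  | Fun 'f "('s, 'f) trm list"

datatype ('s, 'f, 'p, 'a) formula =
    Atom 'p "('s, 'f) trm list"
  | AggAtom 'a "('s, 'f, 'p, 'a) set_expr" "('s, 'f) trm"
  | Neg "('s, 'f, 'p, 'a) formula"
  | Conj "('s, 'f, 'p, 'a) formula" "('s, 'f, 'p, 'a) formula"
  | Disj "('s, 'f, 'p, 'a) formula" "('s, 'f, 'p, 'a) formula"
  | All "'s var" "('s, 'f, 'p, 'a) formula"
  | Ex "'s var" "('s, 'f, 'p, 'a) formula"
and ('s, 'f, 'p, 'a) set_expr =
    SetExpr "'s var list" "('s, 'f, 'p, 'a) formula"

inductive has_sort :: "('s, 'f, 'p, 'a) signature \<Rightarrow> ('s, 'f) trm \<Rightarrow> 's \<Rightarrow> bool" for \<Sigma> where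
  "s \<in> sorts \<Sigma> \<Longrightarrow> has_sort \<Sigma> (Var (x, s)) s"
| "func_decl \<Sigma> f = Some (ss, s) \<Longrightarrow> list_all2 (has_sort \<Sigma>) ts ss \<Longrightarrow> has_sort \<Sigma> (Fun f ts) s"

primrec aggregate_formula ::
    "('s, 'f, 'p, 'a) signature \<Rightarrow> ('s, 'f, 'p, 'a) formula \<Rightarrow> bool"
  and set_expr_of_sort ::
    "('s, 'f, 'p, 'a) signature \<Rightarrow> ('s, 'f, 'p, 'a) set_expr \<Rightarrow> 's list \<Rightarrow> bool"
where
  "aggregate_formula \<Sigma> (Atom p ts) \<longleftrightarrow>
     (\<exists>ss. pred_decl \<Sigma> p = Some ss \<and> list_all2 (has_sort \<Sigma>) ts ss)"
| "aggregate_formula \<Sigma> (AggAtom R e t) \<longleftrightarrow>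
     (\<exists>ss w. agg_decl \<Sigma> R = Some (ss, w) \<and> set_expr_of_sort \<Sigma> e ss \<and> has_sort \<Sigma> t w)"
| "aggregate_formula \<Sigma> (Neg \<phi>) \<longleftrightarrow> aggregate_formula \<Sigma> \<phi>"
| "aggregate_formula \<Sigma> (Conj \<phi> \<psi>) \<longleftrightarrow> aggregate_formula \<Sigma> \<phi> \<and> aggregate_formula \<Sigma> \<psi>"
| "aggregate_formula \<Sigma> (Disj \<phi> \<psi>) \<longleftrightarrow> aggregate_formula \<Sigma> \<phi> \<and> aggregate_formula \<Sigma> \<psi>"
| "aggregate_formula \<Sigma> (All x \<phi>) \<longleftrightarrow> snd x \<in> sorts \<Sigma> \<and> aggregate_formula \<Sigma> \<phi>"
| "aggregate_formula \<Sigma> (Ex x \<phi>) \<longleftrightarrow> snd x \<in> sorts \<Sigma> \<and> aggregate_formula \<Sigma> \<phi>"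
| "set_expr_of_sort \<Sigma> (SetExpr xs \<phi>) =
     (\<lambda>ss. distinct xs \<and> map snd xs = ss \<and> aggregate_formula \<Sigma> \<phi>)"

primrec fv_trm :: "('s, 'f) trm \<Rightarrow> 's var set" where
  "fv_trm (Var x) = {x}"
| "fv_trm (Fun f ts) = \<Union> (set (map fv_trm ts))"

primrec fv :: "('s, 'f, 'p, 'a) formula \<Rightarrow> 's var set"
  and fv_set :: "('s, 'f, 'p, 'a) set_expr \<Rightarrow> 's var set"
where
  "fv (Atom p ts) = \<Union> (set (map fv_trm ts))"
| "fv (AggAtom R e t) = fv_set e \<union> fv_trm t"
| "fv (Neg \<phi>) = fv \<phi>"
| "fv (Conj \<phi> \<psi>) = fv \<phi> \<union> fv \<psi>"
| "fv (Disj \<phi> \<psi>) = fv \<phi> \<union> fv \<psi>"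
| "fv (All x \<phi>) = fv \<phi> - {x}"
| "fv (Ex x \<phi>) = fv \<phi> - {x}"
| "fv_set (SetExpr xs \<phi>) = fv \<phi> - set xs"


subsection \<open>Semantics\<close>

record ('s, 'f, 'p, 'a, 'd) struct =
  carrier :: "'s \<Rightarrow> 'd set"
  func_int :: "'f \<Rightarrow> 'd list \<Rightarrow> 'd"
  pred_int :: "'p \<Rightarrow> 'd list set"
  agg_int :: "'a \<Rightarrow> ('d list set \<times> 'd) set"

definition tuples :: "('s, 'f, 'p, 'a, 'd) struct \<Rightarrow> 's list \<Rightarrow> 'd list set" where
  "tuples \<D> ss = {ds. list_all2 (\<lambda>d s. d \<in> carrier \<D> s) ds ss}"

definition structure_of ::
    "('s, 'f, 'p, 'a) signature \<Rightarrow> ('s, 'f, 'p, 'a, 'd) struct \<Rightarrow> bool" where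
  "structure_of \<Sigma> \<D> \<longleftrightarrow>
     (\<forall>f ss s. func_decl \<Sigma> f = Some (ss, s) \<longrightarrow> func_int \<D> f ` tuples \<D> ss \<subseteq> carrier \<D> s) \<and>
     (\<forall>p ss. pred_decl \<Sigma> p = Some ss \<longrightarrow> pred_int \<D> p \<subseteq> tuples \<D> ss) \<and>
     (\<forall>R ss w. agg_decl \<Sigma> R = Some (ss, w) \<longrightarrow>
        aggregate_relation (tuples \<D> ss) (carrier \<D> w) (agg_int \<D> R))"

primrec eval :: "('s, 'f, 'p, 'a, 'd) struct \<Rightarrow> ('s var \<Rightarrow> 'd) \<Rightarrow> ('s, 'f) trm \<Rightarrow> 'd" where
  "eval \<D> \<nu> (Var x) = \<nu> x"
| "eval \<D> \<nu> (Fun f ts) = func_int \<D> f (map (eval \<D> \<nu>) ts)"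

definition upd :: "('x \<Rightarrow> 'd) \<Rightarrow> 'x list \<Rightarrow> 'd list \<Rightarrow> 'x \<Rightarrow> 'd" where
  "upd \<nu> xs ds x = (case map_of (zip xs ds) x of None \<Rightarrow> \<nu> x | Some d \<Rightarrow> d)"

primrec sat ::
    "('s, 'f, 'p, 'a, 'd) struct \<Rightarrow> ('s, 'f, 'p, 'a) formula \<Rightarrow> ('s var \<Rightarrow> 'd) \<Rightarrow> bool"
  and set_val ::
    "('s, 'f, 'p, 'a, 'd) struct \<Rightarrow> ('s, 'f, 'p, 'a) set_expr \<Rightarrow> ('s var \<Rightarrow> 'd) \<Rightarrow> 'd list set"
where
  "sat \<D> (Atom p ts) = (\<lambda>\<nu>. map (eval \<D> \<nu>) ts \<in> pred_int \<D> p)"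
| "sat \<D> (AggAtom R e t) = (\<lambda>\<nu>. (set_val \<D> e \<nu>, eval \<D> \<nu> t) \<in> agg_int \<D> R)"
| "sat \<D> (Neg \<phi>) = (\<lambda>\<nu>. \<not> sat \<D> \<phi> \<nu>)"
| "sat \<D> (Conj \<phi> \<psi>) = (\<lambda>\<nu>. sat \<D> \<phi> \<nu> \<and> sat \<D> \<psi> \<nu>)"
| "sat \<D> (Disj \<phi> \<psi>) = (\<lambda>\<nu>. sat \<D> \<phi> \<nu> \<or> sat \<D> \<psi> \<nu>)"
| "sat \<D> (All x \<phi>) = (\<lambda>\<nu>. \<forall>d \<in> carrier \<D> (snd x). sat \<D> \<phi> (\<nu>(x := d)))"
| "sat \<D> (Ex x \<phi>) = (\<lambda>\<nu>. \<exists>d \<in> carrier \<D> (snd x). sat \<D> \<phi> (\<nu>(x := d)))"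
| "set_val \<D> (SetExpr xs \<phi>) =
     (\<lambda>\<nu>. {ds \<in> tuples \<D> (map snd xs). sat \<D> \<phi> (upd \<nu> xs ds)})"


subsection \<open>Programs\<close>

(* The defined predicates are given together with their argument sorts. *)
definition defined_predicates ::
    "('s, 'f, 'p, 'a) signature \<Rightarrow> ('p \<rightharpoonup> 's list) \<Rightarrow> bool" where
  "defined_predicates \<Sigma> \<Pi> \<longleftrightarrow>
     dom \<Pi> \<inter> dom (pred_decl \<Sigma>) = {} \<and> (\<forall>ss \<in> ran \<Pi>. set ss \<subseteq> sorts \<Sigma>)"

definition extend_signature ::
    "('s, 'f, 'p, 'a) signature \<Rightarrow> ('p \<rightharpoonup> 's list) \<Rightarrow> ('s, 'f, 'p, 'a) signature" where
  "extend_signature \<Sigma> \<Pi> = \<Sigma>\<lparr>pred_decl := pred_decl \<Sigma> ++ \<Pi>\<rparr>"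

(* ((p, ts), \<phi>) is the rule with head p(ts) and body \<phi>. *)
type_synonym ('s, 'f, 'p, 'a) rule =
  "('p \<times> ('s, 'f) trm list) \<times> ('s, 'f, 'p, 'a) formula"

definition aggregate_program ::
    "('s, 'f, 'p, 'a) signature \<Rightarrow> ('p \<rightharpoonup> 's list) \<Rightarrow> ('s, 'f, 'p, 'a) rule set \<Rightarrow> bool" where
  "aggregate_program \<Sigma> \<Pi> P \<longleftrightarrow>
     (\<forall>((p, ts), \<phi>) \<in> P.
        (\<exists>ss. \<Pi> p = Some ss \<and> list_all2 (has_sort \<Sigma>) ts ss) \<and>
        aggregate_formula (extend_signature \<Sigma> \<Pi>) \<phi>)"

definition base ::
    "('s, 'f, 'p, 'a, 'd) struct \<Rightarrow> ('p \<rightharpoonup> 's list) \<Rightarrow> ('p \<times> 'd list) set" where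
  "base \<D> \<Pi> = {(p, ds). \<exists>ss. \<Pi> p = Some ss \<and> ds \<in> tuples \<D> ss}"

definition extend_structure ::
    "('s, 'f, 'p, 'a, 'd) struct \<Rightarrow> ('p \<rightharpoonup> 's list) \<Rightarrow> ('p \<times> 'd list) set \<Rightarrow>
     ('s, 'f, 'p, 'a, 'd) struct" where
  "extend_structure \<D> \<Pi> I =
     \<D>\<lparr>pred_int := (\<lambda>p. if p \<in> dom \<Pi> then {ds. (p, ds) \<in> I} else pred_int \<D> p)\<rparr>"

(* A ground instance replaces the free variables of a rule by domain elements of their sorts.
   The instantiated body is represented by the body together with the valuation; the head is
   the resulting ground atom over domain elements. *)
definition inst ::
    "('s, 'f, 'p, 'a, 'd) struct \<Rightarrow> ('s, 'f, 'p, 'a) rule set \<Rightarrow>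
     (('p \<times> 'd list) \<times> ('s, 'f, 'p, 'a) formula \<times> ('s var \<Rightarrow> 'd)) set" where
  "inst \<D> P =
     {((p, map (eval \<D> \<nu>) ts), \<phi>, \<nu>) | p ts \<phi> \<nu>.
        ((p, ts), \<phi>) \<in> P \<and>
        (\<forall>x \<in> \<Union> (set (map fv_trm ts)) \<union> fv \<phi>. \<nu> x \<in> carrier \<D> (snd x))}"

definition T_op ::
    "('s, 'f, 'p, 'a, 'd) struct \<Rightarrow> ('p \<rightharpoonup> 's list) \<Rightarrow> ('s, 'f, 'p, 'a) rule set \<Rightarrow>
     ('p \<times> 'd list) set \<Rightarrow> ('p \<times> 'd list) set" where
  "T_op \<D> \<Pi> P I =
     {A. \<exists>\<phi> \<nu>. (A, \<phi>, \<nu>) \<in> inst \<D> P \<and> sat (extend_structure \<D> \<Pi> I) \<phi> \<nu>}"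


subsection \<open>Polarity\<close>

datatype 'a above = AboveNeg | AboveAgg 'a

(* An occurrence is recorded as its predicate and the negations and aggregate atoms above it;
   occurrences that agree on this data have the same polarity. *)
primrec occurrences :: "('s, 'f, 'p, 'a) formula \<Rightarrow> ('p \<times> 'a above list) set"
  and occurrences_set :: "('s, 'f, 'p, 'a) set_expr \<Rightarrow> ('p \<times> 'a above list) set"
where
  "occurrences (Atom p ts) = {(p, [])}"
| "occurrences (AggAtom R e t) = (\<lambda>(p, c). (p, AboveAgg R # c)) ` occurrences_set e"
| "occurrences (Neg \<phi>) = (\<lambda>(p, c). (p, AboveNeg # c)) ` occurrences \<phi>"
| "occurrences (Conj \<phi> \<psi>) = occurrences \<phi> \<union> occurrences \<psi>"
| "occurrences (Disj \<phi> \<psi>) = occurrences \<phi> \<union> occurrences \<psi>"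
| "occurrences (All x \<phi>) = occurrences \<phi>"
| "occurrences (Ex x \<phi>) = occurrences \<phi>"
| "occurrences_set (SetExpr xs \<phi>) = occurrences \<phi>"

definition monotone_symbol ::
    "('s, 'f, 'p, 'a) signature \<Rightarrow> ('s, 'f, 'p, 'a, 'd) struct \<Rightarrow> 'a \<Rightarrow> bool" where
  "monotone_symbol \<Sigma> \<D> R \<longleftrightarrow>
     monotone_aggregate (tuples \<D> (fst (the (agg_decl \<Sigma> R)))) (agg_int \<D> R)"

definition antimonotone_symbol :: "('s, 'f, 'p, 'a, 'd) struct \<Rightarrow> 'a \<Rightarrow> bool" where
  "antimonotone_symbol \<D> R \<longleftrightarrow> antimonotone_aggregate (agg_int \<D> R)"

definition neutral_occ ::
    "('s, 'f, 'p, 'a) signature \<Rightarrow> ('s, 'f, 'p, 'a, 'd) struct \<Rightarrow> 'p \<times> 'a above list \<Rightarrow> bool" where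
  "neutral_occ \<Sigma> \<D> occ \<longleftrightarrow>
     (\<exists>R. AboveAgg R \<in> set (snd occ) \<and>
          \<not> monotone_symbol \<Sigma> \<D> R \<and> \<not> antimonotone_symbol \<D> R)"

primrec reverses :: "('s, 'f, 'p, 'a, 'd) struct \<Rightarrow> 'a above \<Rightarrow> bool" where
  "reverses \<D> AboveNeg \<longleftrightarrow> True"
| "reverses \<D> (AboveAgg R) \<longleftrightarrow> antimonotone_symbol \<D> R"

definition negative_occ ::
    "('s, 'f, 'p, 'a) signature \<Rightarrow> ('s, 'f, 'p, 'a, 'd) struct \<Rightarrow> 'p \<times> 'a above list \<Rightarrow> bool" where
  "negative_occ \<Sigma> \<D> occ \<longleftrightarrow>
     \<not> neutral_occ \<Sigma> \<D> occ \<and> odd (length (filter (reverses \<D>) (snd occ)))"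

definition positive_formula ::
    "('s, 'f, 'p, 'a) signature \<Rightarrow> ('s, 'f, 'p, 'a, 'd) struct \<Rightarrow> ('p \<rightharpoonup> 's list) \<Rightarrow>
     ('s, 'f, 'p, 'a) formula \<Rightarrow> bool" where
  "positive_formula \<Sigma> \<D> \<Pi> \<phi> \<longleftrightarrow>
     (\<forall>occ \<in> occurrences \<phi>. fst occ \<in> dom \<Pi> \<longrightarrow>
        \<not> negative_occ \<Sigma> \<D> occ \<and> \<not> neutral_occ \<Sigma> \<D> occ)"

definition definite_program ::
    "('s, 'f, 'p, 'a) signature \<Rightarrow> ('s, 'f, 'p, 'a, 'd) struct \<Rightarrow> ('p \<rightharpoonup> 's list) \<Rightarrow>
     ('s, 'f, 'p, 'a) rule set \<Rightarrow> bool" where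
  "definite_program \<Sigma> \<D> \<Pi> P \<longleftrightarrow>
     (\<forall>(A, \<phi>) \<in> P. positive_formula \<Sigma> \<D> \<Pi> \<phi>)"

end

theory Submission
  imports Defs
begin

text \<open>
  A formula whose \<open>\<Pi>\<close>-occurrences all have the same polarity is monotone or antitone in the
  interpretation of \<open>\<Pi>\<close>, by induction on the formula: negations and antimonotone aggregates
  exchange the two cases, monotone aggregates preserve them. An aggregate that is neither monotone
  nor antimonotone can only have conditions without \<open>\<Pi>\<close>-occurrences; such a condition is
  vacuously of both polarities, so it denotes the same set in all interpretations.
\<close>

text \<open>Stated for sets of occurrences so that it covers formulas and set expressions alike. The
  flag \<open>neg\<close> is the required parity: \<open>True\<close> for odd, \<open>False\<close>
  for even. Without occurrences of \<Pi> both values hold.\<close>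

definition uniform_polarity ::
    "('s, 'f, 'p, 'a) signature \<Rightarrow> ('s, 'f, 'p, 'a, 'd) struct \<Rightarrow> ('p \<rightharpoonup> 's list) \<Rightarrow> bool \<Rightarrow>
     ('p \<times> 'a above list) set \<Rightarrow> bool" where
  "uniform_polarity \<Sigma> \<D> \<Pi> neg Occ \<longleftrightarrow>
     (\<forall>(p, c) \<in> Occ. p \<in> dom \<Pi> \<longrightarrow>
        \<not> neutral_occ \<Sigma> \<D> (p, c) \<and> odd (length (filter (reverses \<D>) c)) = neg)"

lemma uniform_polarity_Un [simp]:
  "uniform_polarity \<Sigma> \<D> \<Pi> neg (A \<union> B) \<longleftrightarrow>
     uniform_polarity \<Sigma> \<D> \<Pi> neg A \<and> uniform_polarity \<Sigma> \<D> \<Pi> neg B"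
  unfolding uniform_polarity_def by blast

lemma uniform_polarity_AboveNeg [simp]:
  "uniform_polarity \<Sigma> \<D> \<Pi> neg ((\<lambda>(p, c). (p, AboveNeg # c)) ` A) \<longleftrightarrow>
     uniform_polarity \<Sigma> \<D> \<Pi> (\<not> neg) A"
  unfolding uniform_polarity_def neutral_occ_def by fastforce

text \<open>\<open>reverses\<close> tests antimonotonicity only, so a symbol that is also monotone
  still flips the parity and belongs to this case.\<close>

lemma uniform_polarity_AboveAgg_antimonotone:
  assumes "antimonotone_symbol \<D> R"
  shows "uniform_polarity \<Sigma> \<D> \<Pi> neg ((\<lambda>(p, c). (p, AboveAgg R # c)) ` A) \<longleftrightarrow>
     uniform_polarity \<Sigma> \<D> \<Pi> (\<not> neg) A"
  using assms unfolding uniform_polarity_def neutral_occ_def by fastforce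

lemma uniform_polarity_AboveAgg_monotone:
  assumes "monotone_symbol \<Sigma> \<D> R" "\<not> antimonotone_symbol \<D> R"
  shows "uniform_polarity \<Sigma> \<D> \<Pi> neg ((\<lambda>(p, c). (p, AboveAgg R # c)) ` A) \<longleftrightarrow>
     uniform_polarity \<Sigma> \<D> \<Pi> neg A"
  using assms unfolding uniform_polarity_def neutral_occ_def by fastforce

text \<open>Everything below \<open>R\<close> is neutral, so the hypothesis leaves no predicate of
  \<Pi> in \<open>A\<close>, and the conclusion is vacuous for any \<open>neg'\<close>.\<close>

lemma uniform_polarity_AboveAgg_neutral:
  assumes "\<not> monotone_symbol \<Sigma> \<D> R" "\<not> antimonotone_symbol \<D> R"
    and "uniform_polarity \<Sigma> \<D> \<Pi> neg ((\<lambda>(p, c). (p, AboveAgg R # c)) ` A)"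
  shows "uniform_polarity \<Sigma> \<D> \<Pi> neg' A"
  using assms unfolding uniform_polarity_def neutral_occ_def by fastforce

lemma extend_structure_simps [simp]:
  "carrier (extend_structure \<D> \<Pi> I) = carrier \<D>"
  "func_int (extend_structure \<D> \<Pi> I) = func_int \<D>"
  "agg_int (extend_structure \<D> \<Pi> I) = agg_int \<D>"
  "pred_int (extend_structure \<D> \<Pi> I) p =
     (if p \<in> dom \<Pi> then {ds. (p, ds) \<in> I} else pred_int \<D> p)"
  "tuples (extend_structure \<D> \<Pi> I) = tuples \<D>"
  by (simp_all add: extend_structure_def tuples_def fun_eq_iff)

lemma eval_extend_structure [simp]: "eval (extend_structure \<D> \<Pi> I) = eval \<D>"
proof (intro ext)
  fix \<nu> t
  show "eval (extend_structure \<D> \<Pi> I) \<nu> t = eval \<D> \<nu> t"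
    by (induction t) (auto cong: map_cong)
qed

lemma agg_decl_extend_signature [simp]: "agg_decl (extend_signature \<Sigma> \<Pi>) = agg_decl \<Sigma>"
  by (simp add: extend_signature_def)

lemma set_val_subset_tuples:
  "set_expr_of_sort \<Sigma> e ss \<Longrightarrow> set_val \<D> e \<nu> \<subseteq> tuples \<D> ss"
  by (cases e) auto

text \<open>Truth always passes from \<open>I\<close> to \<open>J\<close>; \<open>neg\<close> only
  decides which of the two is the larger. Hence a polarity flip amounts to exchanging
  \<open>I\<close> and \<open>J\<close> in the induction hypothesis.\<close>

lemma sat_mono_of_uniform_polarity:
  fixes \<phi> :: "('s, 'f, 'p, 'a) formula" and e :: "('s, 'f, 'p, 'a) set_expr"
  shows "\<lbrakk>aggregate_formula (extend_signature \<Sigma> \<Pi>) \<phi>;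
      uniform_polarity \<Sigma> \<D> \<Pi> neg (occurrences \<phi>); if neg then J \<subseteq> I else I \<subseteq> J;
      sat (extend_structure \<D> \<Pi> I) \<phi> \<nu>\<rbrakk> \<Longrightarrow> sat (extend_structure \<D> \<Pi> J) \<phi> \<nu>"
    and "\<lbrakk>set_expr_of_sort (extend_signature \<Sigma> \<Pi>) e ss;
      uniform_polarity \<Sigma> \<D> \<Pi> neg (occurrences_set e); if neg then J \<subseteq> I else I \<subseteq> J\<rbrakk> \<Longrightarrow>
      set_val (extend_structure \<D> \<Pi> I) e \<nu> \<subseteq> set_val (extend_structure \<D> \<Pi> J) e \<nu>"
proof (induction \<phi> and e arbitrary: neg I J \<nu> and neg I J \<nu> ss)
  case (Atom p ts)
  \<comment> \<open>Nothing is above an atom, so its parity is even: \<open>p\<close> in \<Pi>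
    forces \<open>neg\<close> to be \<open>False\<close>, that is
    \<open>I \<subseteq> J\<close>.\<close>
  then show ?case
    by (auto simp: uniform_polarity_def neutral_occ_def split: if_splits)
next
  case (AggAtom R e t)
  let ?I = "extend_structure \<D> \<Pi> I" and ?J = "extend_structure \<D> \<Pi> J"
  obtain ss w where R: "agg_decl \<Sigma> R = Some (ss, w)"
    and e: "set_expr_of_sort (extend_signature \<Sigma> \<Pi>) e ss"
    using AggAtom.prems(1) by auto
  \<comment> \<open>\<open>monotone_aggregate\<close> allows enlarging a set only within the domain
    of the relation.\<close>
  have J: "set_val ?J e \<nu> \<subseteq> tuples \<D> ss"
    using set_val_subset_tuples[OF e, of ?J] by simp
  have I: "(set_val ?I e \<nu>, eval \<D> \<nu> t) \<in> agg_int \<D> R"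
    using AggAtom.prems(4) by simp
  have pol: "uniform_polarity \<Sigma> \<D> \<Pi> neg ((\<lambda>(p, c). (p, AboveAgg R # c)) ` occurrences_set e)"
    using AggAtom.prems(2) by simp
  consider (anti) "antimonotone_symbol \<D> R"
    | (mono) "monotone_symbol \<Sigma> \<D> R" "\<not> antimonotone_symbol \<D> R"
    | (neutral) "\<not> monotone_symbol \<Sigma> \<D> R" "\<not> antimonotone_symbol \<D> R"
    by blast
  then have "(set_val ?J e \<nu>, eval \<D> \<nu> t) \<in> agg_int \<D> R"
  proof cases
    case anti
    then have "uniform_polarity \<Sigma> \<D> \<Pi> (\<not> neg) (occurrences_set e)"
      using pol by (simp add: uniform_polarity_AboveAgg_antimonotone)
    then have "set_val ?J e \<nu> \<subseteq> set_val ?I e \<nu>"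
      using AggAtom.prems(3) by (intro AggAtom.IH[OF e]) auto
    with anti I show ?thesis
      unfolding antimonotone_symbol_def antimonotone_aggregate_def by blast
  next
    case mono
    then have "uniform_polarity \<Sigma> \<D> \<Pi> neg (occurrences_set e)"
      using pol by (simp add: uniform_polarity_AboveAgg_monotone)
    then have "set_val ?I e \<nu> \<subseteq> set_val ?J e \<nu>"
      using AggAtom.prems(3) by (intro AggAtom.IH[OF e]) auto
    with mono(1) I J R show ?thesis
      unfolding monotone_symbol_def monotone_aggregate_def by auto
  next
    case neutral
    then have pol': "uniform_polarity \<Sigma> \<D> \<Pi> neg' (occurrences_set e)" for neg'
      using pol by (rule uniform_polarity_AboveAgg_neutral)
    \<comment> \<open>Polarity \<open>neg\<close> gives one inclusion; the opposite polarity, with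
      \<open>I\<close> and \<open>J\<close> exchanged, gives the other.\<close>
    have "set_val ?I e \<nu> = set_val ?J e \<nu>"
      using AggAtom.IH[OF e pol'[of neg], of J I] AggAtom.IH[OF e pol'[of "\<not> neg"], of I J]
        AggAtom.prems(3) by (cases neg) (simp_all add: subset_antisym)
    with I show ?thesis by simp
  qed
  then show ?case by simp
next
  case (Neg \<phi>)
  \<comment> \<open>The hypothesis carries truth of the subformula from \<open>J\<close> to
    \<open>I\<close>; its contrapositive is the claim.\<close>
  then show ?case using Neg.IH[of "\<not> neg" I J \<nu>] by (auto split: if_splits)
next
  case (Conj \<phi> \<psi>)
  then show ?case using Conj.IH[of neg J I \<nu>] by simp
next
  case (Disj \<phi> \<psi>)
  then show ?case using Disj.IH[of neg J I \<nu>] by auto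
next
  case (All x \<phi>)
  then show ?case using All.IH[of neg J I] by simp
next
  case (Ex x \<phi>)
  have "sat (extend_structure \<D> \<Pi> I) \<phi> \<nu> \<Longrightarrow> sat (extend_structure \<D> \<Pi> J) \<phi> \<nu>" for \<nu>
    using Ex.prems by (intro Ex.IH[of neg J I]) auto
  with Ex.prems(4) show ?case by auto
next
  case (SetExpr xs \<phi>)
  \<comment> \<open>Every valuation is needed, since each tuple of the set is tested under its own
    update of \<nu>.\<close>
  have "sat (extend_structure \<D> \<Pi> I) \<phi> \<nu> \<Longrightarrow> sat (extend_structure \<D> \<Pi> J) \<phi> \<nu>" for \<nu>
    using SetExpr.prems by (intro SetExpr.IH[of neg J I]) auto
  then show ?case by auto
qed

text \<open>An occurrence that is neither neutral nor negative has even parity.\<close>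

lemma positive_formula_uniform_polarity:
  "positive_formula \<Sigma> \<D> \<Pi> \<phi> \<longleftrightarrow> uniform_polarity \<Sigma> \<D> \<Pi> False (occurrences \<phi>)"
  unfolding positive_formula_def uniform_polarity_def negative_occ_def by fastforce

theorem theorem4:
  fixes \<Sigma> :: "('s, 'f, 'p, 'a) signature"
    and \<D> :: "('s, 'f, 'p, 'a, 'd) struct"
    and \<Pi> :: "'p \<rightharpoonup> 's list"
    and P :: "('s, 'f, 'p, 'a) rule set"
  assumes "aggregate_signature \<Sigma>"
    and "structure_of \<Sigma> \<D>"
    and "defined_predicates \<Sigma> \<Pi>"
    and "aggregate_program \<Sigma> \<Pi> P"
    and "definite_program \<Sigma> \<D> \<Pi> P"
  shows "mono_on (Pow (base \<D> \<Pi>)) (T_op \<D> \<Pi> P)"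
proof (rule mono_onI)
  fix I J :: "('p \<times> 'd list) set"
  assume "I \<subseteq> J"
  show "T_op \<D> \<Pi> P I \<subseteq> T_op \<D> \<Pi> P J"
  proof
    fix A assume "A \<in> T_op \<D> \<Pi> P I"
    then obtain \<phi> \<nu> where inst: "(A, \<phi>, \<nu>) \<in> inst \<D> P"
      and sat: "sat (extend_structure \<D> \<Pi> I) \<phi> \<nu>"
      unfolding T_op_def by blast
    obtain p ts where "((p, ts), \<phi>) \<in> P"
      using inst unfolding inst_def by blast
    then have "aggregate_formula (extend_signature \<Sigma> \<Pi>) \<phi>"
      and "uniform_polarity \<Sigma> \<D> \<Pi> False (occurrences \<phi>)"
      using assms(4,5)
      unfolding aggregate_program_def definite_program_def
        positive_formula_uniform_polarity[symmetric]
      by auto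
    then have "sat (extend_structure \<D> \<Pi> J) \<phi> \<nu>"
      using sat \<open>I \<subseteq> J\<close> sat_mono_of_uniform_polarity(1)[where neg = False] by simp
    \<comment> \<open>Rule instances do not depend on the interpretation, so the same one derives
      \<open>A\<close> from \<open>J\<close>.\<close>
    with inst show "A \<in> T_op \<D> \<Pi> P J"
      unfolding T_op_def by blast
  qed
qed

end
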